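(* Let $n>3$ be an integer. Every Cayley matrix of order $n$ with at most $n-1$ holes can be reconstructed by the quadrangle criterion, and moreover the order in which the holes are to be filled can be chosen in advance. Explicitly: let $M$ be an $n\times n$ Cayley matrix, let $P$ be a partial matrix obtained from $M$ by deleting the entries in a set of $m\le n-1$ cells (the holes of $P$), and let $d_1,\dots,d_m$ be an arbitrary enumeration of these holes. Then the holes can be filled by the quadrangle criterion one after another in the order $d_1,d_2,\dots,d_m$ (where, for each $k$, the hole $d_k$ is filled by the quadrangle criterion in the partial matrix in which $d_1,\dots,d_{k-1}$ have already been filled and $d_k,\dots,d_m$ are still holes), and the resulting matrix is $M$.
   Context: For a cell $c=(i,j)$ (row $i$, column $j$) of an $n\times n$ matrix $M=(m_{i,j})$, write $v(c)=m_{i,j}$ for the entry of $M$ in $c$. A quadrangle is a quadruple $(c_1,c_2,c_3,c_4)$ of cells that are the four corners of a rectangular block with at least two rows and two columns, such that $c_1,c_3$ lie on one diagonal of the block. When quadrangles are compared, they are written with the same orientation: there are rows $p\neq q$ and columns $r\neq s$ with $c_1=(p,r)$, $c_2=(q,r)$, $c_3=(q,s)$, $c_4=(p,s)$. $M$ satisfies the quadrangle criterion if $v(c_4)=v(d_4)$ whenever $(c_1,c_2,c_3,c_4)$ and $(d_1,d_2,d_3,d_4)$ are two quadrangles with $v(c_i)=v(d_i)$ for $i=1,2,3$. A Cayley matrix of order $n$ is an $n\times n$ Latin square satisfying the quadrangle criterion; equivalently, there are a group $G$ of order $n$ and two enumerations $g_1,\dots,g_n$ and $h_1,\dots,h_n$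 of its elements such that $m_{i,j}=g_i\cdot h_j$ for all $i,j$. A partial matrix $P$ is obtained from $M$ by deleting the entries in some cells; these cells are called holes. A hole $d_4$ of a partial matrix $P$ can be filled by the quadrangle criterion if there are two quadrangles $(c_1,c_2,c_3,c_4)$ and $(d_1,d_2,d_3,d_4)$ such that none of the cells $c_1,c_2,c_3,c_4,d_1,d_2,d_3$ is a hole of $P$ and $v(c_i)=v(d_i)$ for $i=1,2,3$; the hole $d_4$ is then filled with the value $v(c_4)$. *)

theory Defs
  imports "Jordan_Normal_Form.Matrix"
begin

text \<open>
  Matrices are those of the library, with rows and columns indexed from 0. A partial matrix is a
  matrix with entries in an option type; a hole is a cell with entry \<^const>\<open>None\<close>.
\<close>

type_synonym cell = "nat \<times> nat"

definition cells :: "nat \<Rightarrow> cell set" where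
  "cells n = {..<n} \<times> {..<n}"

text \<open>
  The orientation is part of the definition. The other one, with \<open>c\<^sub>2\<close> in the row of \<open>c\<^sub>1\<close>, is
  obtained by exchanging \<open>c\<^sub>1\<close> and \<open>c\<^sub>3\<close>, so comparing two quadrangles that both have the other
  orientation gives nothing new.
\<close>

definition quadrangle :: "nat \<Rightarrow> cell \<Rightarrow> cell \<Rightarrow> cell \<Rightarrow> cell \<Rightarrow> bool" where
  "quadrangle n c1 c2 c3 c4 \<longleftrightarrow>
    (\<exists>p q r s. p < n \<and> q < n \<and> r < n \<and> s < n \<and> p \<noteq> q \<and> r \<noteq> s \<and>
       c1 = (p, r) \<and> c2 = (q, r) \<and> c3 = (q, s) \<and> c4 = (p, s))"

definition latin_square :: "nat \<Rightarrow> 'a mat \<Rightarrow> bool" where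
  "latin_square n M \<longleftrightarrow> M \<in> carrier_mat n n \<and>
    (\<exists>S. finite S \<and> card S = n \<and>
       (\<forall>i<n. bij_betw (\<lambda>j. M $$ (i, j)) {..<n} S) \<and>
       (\<forall>j<n. bij_betw (\<lambda>i. M $$ (i, j)) {..<n} S))"

definition quadrangle_criterion :: "nat \<Rightarrow> 'a mat \<Rightarrow> bool" where
  "quadrangle_criterion n M \<longleftrightarrow>
    (\<forall>c1 c2 c3 c4 d1 d2 d3 d4.
       quadrangle n c1 c2 c3 c4 \<and> quadrangle n d1 d2 d3 d4 \<and>
       M $$ c1 = M $$ d1 \<and> M $$ c2 = M $$ d2 \<and> M $$ c3 = M $$ d3 \<longrightarrow>
       M $$ c4 = M $$ d4)"

definition cayley_matrix :: "nat \<Rightarrow> 'a mat \<Rightarrow> bool" where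
  "cayley_matrix n M \<longleftrightarrow> latin_square n M \<and> quadrangle_criterion n M"

definition delete_entries :: "'a mat \<Rightarrow> cell set \<Rightarrow> 'a option mat" where
  "delete_entries M H =
    mat (dim_row M) (dim_col M) (\<lambda>c. if c \<in> H then None else Some (M $$ c))"

definition fillable :: "nat \<Rightarrow> 'a option mat \<Rightarrow> cell \<Rightarrow> 'a \<Rightarrow> bool" where
  "fillable n P d4 x \<longleftrightarrow> P $$ d4 = None \<and>
    (\<exists>c1 c2 c3 c4 d1 d2 d3.
       quadrangle n c1 c2 c3 c4 \<and> quadrangle n d1 d2 d3 d4 \<and>
       (\<forall>c \<in> {c1, c2, c3, c4, d1, d2, d3}. P $$ c \<noteq> None) \<and>
       P $$ c1 = P $$ d1 \<and> P $$ c2 = P $$ d2 \<and> P $$ c3 = P $$ d3 \<and>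
       P $$ c4 = Some x)"

text \<open>
  \<open>fills_to n P ds Q\<close>: filling the cells \<open>ds\<close> of \<open>P\<close> by the quadrangle criterion, one after another
  in the order of the list, is possible with result \<open>Q\<close>.
\<close>

fun fills_to :: "nat \<Rightarrow> 'a option mat \<Rightarrow> cell list \<Rightarrow> 'a option mat \<Rightarrow> bool" where
  "fills_to n P [] Q \<longleftrightarrow> Q = P"
| "fills_to n P (d # ds) Q \<longleftrightarrow>
    (\<exists>x. fillable n P d x \<and> fills_to n (update_mat P d (Some x)) ds Q)"

end

theory Submission
  imports Defs
begin

text \<open>
  It suffices to fill one hole \<open>d = (i\<^sub>0, j\<^sub>0)\<close> while all the others, at most \<open>n - 2\<close>, are
  still open: the value obtained is the right one because \<open>M\<close> satisfies the criterion
  (\<open>fillable_value_unique\<close>), and afterwards there is one hole less.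

  Fix a row \<open>q \<noteq> i\<^sub>0\<close> and a column \<open>r \<noteq> j\<^sub>0\<close>. The block spanned by \<open>(i\<^sub>0, j\<^sub>0)\<close> and \<open>(q, r)\<close>
  has corner values
  \<open>\<alpha> = M(i\<^sub>0, j\<^sub>0)\<close>, \<open>\<beta> = M(i\<^sub>0, r)\<close>, \<open>\<gamma> = M(q, r)\<close>, \<open>\<delta> = M(q, j\<^sub>0)\<close>.
  Every row \<open>t\<close> is the first row of exactly one block with these corner values: the cells of \<open>\<alpha>\<close>
  and \<open>\<beta>\<close> in row \<open>t\<close> determine its columns, the cell of \<open>\<gamma>\<close> in the column of \<open>\<beta>\<close> determines
  its second row, and the criterion gives \<open>\<delta>\<close> in the last corner
  (\<open>ex_equal_quadrangle_in_row\<close>). So there are \<open>n\<close> copies of the block. In terms of a group they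
  are its translates \<open>(p, s) \<mapsto> (p g, g\<^sup>-\<^sup>1 s)\<close>.

  If the four values are distinct, then a cell belongs to at most one copy, because its value tells
  which corner it is and each corner determines the copy. Hence the at most \<open>n - 1\<close> holes meet at
  most \<open>n - 1\<close> copies, and some copy has no hole. Comparing this copy with the original block fills
  \<open>d\<close>, provided that the three other corners of the original block are not holes. The corners in
  a common row or column always have distinct values, so only \<open>\<alpha> \<noteq> \<gamma>\<close> and \<open>\<beta> \<noteq> \<delta>\<close> are
  restrictions. The second can be relaxed: \<open>\<beta> = \<delta>\<close> does no harm if no hole has the value \<open>\<beta>\<close>.

  It remains to find \<open>q\<close> and \<open>r\<close> (\<open>ex_corner\<close>). Fewer than \<open>n\<close> holes leave some column \<open>r\<close>
  without holes; if column \<open>j\<^sub>0\<close> has at most \<open>n - 3\<close> holes, then some row \<open>q\<close> avoids them and the at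
  most two rows excluded by \<open>\<alpha> \<noteq> \<gamma>\<close> and \<open>\<beta> \<noteq> \<delta>\<close>. The same works with rows and columns
  exchanged. If both row \<open>i\<^sub>0\<close> and column \<open>j\<^sub>0\<close> have at least \<open>n - 2\<close> holes, then, as \<open>n > 3\<close>,
  these are all the holes, and the relaxed condition on \<open>\<beta>\<close> and \<open>\<delta>\<close> holds automatically.
\<close>

section \<open>Choosing the block around a hole\<close>

lemma ex_below_notin:
  fixes B :: "nat set"
  assumes "finite B" "card B < n"
  shows "\<exists>k<n. k \<notin> B"
proof (rule ccontr)
  assume "\<not> (\<exists>k<n. k \<notin> B)"
  then have "{..<n} \<subseteq> B" by auto
  from card_mono[OF assms(1) this] assms(2) show False by simp
qed

text \<open>
  The choice of the block uses only that no value is repeated in a row or a column. Functions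
  instead of matrices make the exchange of rows and columns a swap of arguments.
\<close>

definition injective_lines :: "nat \<Rightarrow> (nat \<Rightarrow> nat \<Rightarrow> 'a) \<Rightarrow> bool" where
  "injective_lines n f \<longleftrightarrow>
    (\<forall>i<n. inj_on (f i) {..<n}) \<and> (\<forall>j<n. inj_on (\<lambda>i. f i j) {..<n})"

lemma injective_lines_rowD:
  "\<lbrakk>injective_lines n f; f i j = f i j'; i < n; j < n; j' < n\<rbrakk> \<Longrightarrow> j = j'"
  by (auto simp: injective_lines_def inj_on_def)

lemma injective_lines_colD:
  "\<lbrakk>injective_lines n f; f i j = f i' j; i < n; i' < n; j < n\<rbrakk> \<Longrightarrow> i = i'"
  by (auto simp: injective_lines_def inj_on_def)

lemma injective_lines_transpose:
  "injective_lines n f \<Longrightarrow> injective_lines n (\<lambda>i j. f j i)"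
  by (auto simp: injective_lines_def)

lemma card_rows_with_value_le_1:
  assumes "injective_lines n f" "j < n"
  shows "card {i. i < n \<and> f i j = v} \<le> 1"
  using injective_lines_colD[OF assms(1)] assms(2)
  by (auto simp: card_le_Suc0_iff_eq)

text \<open>
  Once \<open>r\<close> is a column without holes, the row \<open>q\<close> has to avoid the holes of column \<open>j\<^sub>0\<close> and, for
  each of the two inequalities, at most one row, since a column contains each value at most once.
\<close>

lemma ex_corner_few_holes_in_column:
  assumes f: "injective_lines n f"
    and H: "finite H" "card H < n"
    and j0: "j0 < n"
    and few: "card {i. (i, j0) \<in> H} + 3 \<le> n"
  shows "\<exists>q<n. \<exists>r<n. (q, j0) \<notin> H \<and> (i0, r) \<notin> H \<and> (q, r) \<notin> H \<and>
           f q r \<noteq> f i0 j0 \<and> f q j0 \<noteq> f i0 r"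
proof -
  have "card (snd ` H) < n"
    using card_image_le[OF H(1), of snd] H(2) by linarith
  then obtain r where r: "r < n" "r \<notin> snd ` H"
    using ex_below_notin H(1) by blast
  let ?A = "{i. (i, j0) \<in> H}"
  let ?B = "{i. i < n \<and> f i r = f i0 j0}"
  let ?C = "{i. i < n \<and> f i j0 = f i0 r}"
  have fin: "finite ?A"
    by (rule finite_subset[of _ "fst ` H"]) (use H(1) in force)+
  have "card (?A \<union> ?B \<union> ?C) \<le> card ?A + card ?B + card ?C"
    by (meson add_le_mono card_Un_le le_refl le_trans)
  also have "\<dots> \<le> card ?A + 1 + 1"
    using card_rows_with_value_le_1[OF f r(1)] card_rows_with_value_le_1[OF f j0]
    by (intro add_mono) auto
  also have "\<dots> < n" using few by linarith
  finally obtain q where "q < n" "q \<notin> ?A \<union> ?B \<union> ?C"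
    using ex_below_notin[of "?A \<union> ?B \<union> ?C"] fin by auto
  with r show ?thesis by force
qed

text \<open>
  If neither row \<open>i\<^sub>0\<close> nor column \<open>j\<^sub>0\<close> has few holes, then the at least \<open>2 n - 5 \<ge> n - 1\<close> holes on
  this cross are all the holes. A hole with the value \<open>\<beta>\<close> of \<open>(i\<^sub>0, r)\<close> then lies in column
  \<open>j\<^sub>0\<close>, as row \<open>i\<^sub>0\<close> already has \<open>\<beta>\<close> in the filled cell \<open>(i\<^sub>0, r)\<close>; and if \<open>(q, j\<^sub>0)\<close>, which is
  filled too, also had the value \<open>\<beta>\<close>, then column \<open>j\<^sub>0\<close> would contain it twice.
\<close>

lemma ex_corner:
  assumes f: "injective_lines n f"
    and n: "n > 3"
    and H: "H \<subseteq> cells n" "card H < n"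
    and d: "(i0, j0) \<in> H"
  shows "\<exists>q<n. \<exists>r<n. (q, j0) \<notin> H \<and> (i0, r) \<notin> H \<and> (q, r) \<notin> H \<and>
           f q r \<noteq> f i0 j0 \<and> (f q j0 \<noteq> f i0 r \<or> (\<forall>(x, y)\<in>H. f x y \<noteq> f i0 r))"
proof -
  have fin: "finite H" using H(1) by (rule finite_subset) (simp add: cells_def)
  have ij: "i0 < n" "j0 < n" using d H(1) by (auto simp: cells_def)
  let ?C = "{i. (i, j0) \<in> H}" and ?R = "{j. (i0, j) \<in> H}"
  consider (col) "card ?C + 3 \<le> n" | (row) "card ?R + 3 \<le> n"
    | (cross) "card ?C + 3 > n" "card ?R + 3 > n" by linarith
  then show ?thesis
  proof cases
    case col
    from ex_corner_few_holes_in_column[OF f fin H(2) ij(2) this, of i0] show ?thesis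
      by blast
  next
    case row
    have "finite (H\<inverse>)" "card (H\<inverse>) < n" "card {j. (j, i0) \<in> H\<inverse>} + 3 \<le> n"
      using fin H(2) row by (auto simp: card_inverse)
    from ex_corner_few_holes_in_column[OF injective_lines_transpose[OF f] this(1,2) ij(1) this(3), of j0]
    obtain r q where "r < n" "q < n" "(r, i0) \<notin> H\<inverse>" "(j0, q) \<notin> H\<inverse>" "(r, q) \<notin> H\<inverse>"
      "f q r \<noteq> f i0 j0" "f i0 r \<noteq> f q j0" by blast
    then show ?thesis by (metis converse_iff)
  next
    case cross
    let ?X = "(\<lambda>i. (i, j0)) ` ?C" and ?Y = "Pair i0 ` ?R"
    have sub: "?X \<union> ?Y \<subseteq> H" by auto
    have finX: "finite ?X" "finite ?Y" using sub fin finite_subset by auto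
    have cX: "card ?X = card ?C" and cY: "card ?Y = card ?R"
      by (auto intro!: card_image inj_onI)
    have "?X \<inter> ?Y = {(i0, j0)}" using d by auto
    with card_Un_Int[OF finX] cX cY have cU: "card ?C + card ?R = card (?X \<union> ?Y) + 1"
      by simp
    have le: "card (?X \<union> ?Y) \<le> card H" using card_mono[OF fin sub] .
    have "?X \<union> ?Y = H"
      using card_seteq[OF fin sub] cU cross n H(2) by linarith
    then have HXY: "x = i0 \<or> y = j0" if "(x, y) \<in> H" for x y using that by auto
    have "card ?C < n" "card ?R + 1 < n" using cU cross n H(2) le by linarith+
    moreover have fCR: "finite ?C" "finite ?R"
      using finX finite_imageD by (auto simp: inj_on_def)
    ultimately obtain q where q: "q < n" "q \<notin> ?C"
      using ex_below_notin by blast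
    let ?B = "{j. j < n \<and> f q j = f i0 j0}"
    have "card (?R \<union> ?B) < n"
      using card_Un_le[of ?R ?B] \<open>card ?R + 1 < n\<close>
        card_rows_with_value_le_1[OF injective_lines_transpose[OF f] q(1), of "f i0 j0"]
      by linarith
    then obtain r where r: "r < n" "r \<notin> ?R \<union> ?B"
      using ex_below_notin[of "?R \<union> ?B"] fCR by auto
    have "(q, r) \<notin> H" using HXY q r d by auto
    moreover have "\<forall>(x, y)\<in>H. f x y \<noteq> f i0 r" if e: "f q j0 = f i0 r"
    proof clarify
      fix x y assume xy: "(x, y) \<in> H" and eq: "f x y = f i0 r"
      have b: "x < n" "y < n" using xy H(1) by (auto simp: cells_def)
      from HXY[OF xy] show False
      proof
        assume "x = i0"
        then show False using injective_lines_rowD[OF f] eq b r xy by auto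
      next
        assume "y = j0"
        then have "x = q" using injective_lines_colD[OF f, of x j0 q] eq e b q by auto
        then show False using \<open>y = j0\<close> xy q by auto
      qed
    qed
    ultimately show ?thesis using q r by blast
  qed
qed

section \<open>Copies of a block\<close>

lemma latin_square_injective_lines:
  "latin_square n M \<Longrightarrow> injective_lines n (\<lambda>i j. M $$ (i, j))"
  by (auto simp: latin_square_def injective_lines_def bij_betw_def)

lemma latin_square_value_in_row:
  assumes "latin_square n M" "i < n" "j < n" "i' < n"
  shows "\<exists>j'<n. M $$ (i', j') = M $$ (i, j)"
proof -
  from assms(1) obtain S where "\<forall>i<n. bij_betw (\<lambda>j. M $$ (i, j)) {..<n} S"
    unfolding latin_square_def by blast
  then have "\<forall>i<n. (\<lambda>j. M $$ (i, j)) ` {..<n} = S"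
    by (simp add: bij_betw_def)
  then have "M $$ (i, j) \<in> (\<lambda>j. M $$ (i', j)) ` {..<n}" using assms by blast
  then show ?thesis by (metis (no_types, lifting) imageE lessThan_iff)
qed

lemma latin_square_value_in_column:
  assumes "latin_square n M" "i < n" "j < n" "j' < n"
  shows "\<exists>i'<n. M $$ (i', j') = M $$ (i, j)"
proof -
  from assms(1) obtain S where "\<forall>i<n. bij_betw (\<lambda>j. M $$ (i, j)) {..<n} S"
    "\<forall>j<n. bij_betw (\<lambda>i. M $$ (i, j)) {..<n} S"
    unfolding latin_square_def by blast
  then have "\<forall>i<n. (\<lambda>j. M $$ (i, j)) ` {..<n} = S"
    "\<forall>j<n. (\<lambda>i. M $$ (i, j)) ` {..<n} = S"
    by (simp_all add: bij_betw_def)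
  then have "M $$ (i, j) \<in> (\<lambda>i. M $$ (i, j')) ` {..<n}" using assms by blast
  then show ?thesis by (metis (no_types, lifting) imageE lessThan_iff)
qed

lemma quadrangle_in_cells:
  "quadrangle n c1 c2 c3 c4 \<Longrightarrow> {c1, c2, c3, c4} \<subseteq> cells n"
  by (auto simp: quadrangle_def cells_def)

text \<open>
  The criterion is applied to the quadrangles whose fourth corners are \<open>(u, j)\<close> and \<open>(q, j\<^sub>0)\<close>.
  The value \<open>M $$ (q, j\<^sub>0)\<close> in the last corner is what distinguishes Cayley matrices here from
  other Latin squares.
\<close>

lemma ex_equal_quadrangle_in_row:
  assumes M: "latin_square n M" "quadrangle_criterion n M"
    and lt: "i0 < n" "j0 < n" "q < n" "r < n"
    and ne: "q \<noteq> i0" "r \<noteq> j0"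
    and t: "t < n"
  shows "\<exists>j<n. \<exists>j'<n. \<exists>u<n. u \<noteq> t \<and> j' \<noteq> j \<and>
     M $$ (t, j) = M $$ (i0, j0) \<and> M $$ (t, j') = M $$ (i0, r) \<and>
     M $$ (u, j') = M $$ (q, r) \<and> M $$ (u, j) = M $$ (q, j0)"
proof -
  note inj = latin_square_injective_lines[OF M(1)]
  obtain j where j: "j < n" "M $$ (t, j) = M $$ (i0, j0)"
    using latin_square_value_in_row[OF M(1) lt(1,2) t] by blast
  obtain j' where j': "j' < n" "M $$ (t, j') = M $$ (i0, r)"
    using latin_square_value_in_row[OF M(1) lt(1,4) t] by blast
  obtain u where u: "u < n" "M $$ (u, j') = M $$ (q, r)"
    using latin_square_value_in_column[OF M(1) lt(3,4) j'(1)] by blast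
  have jj: "j' \<noteq> j" using injective_lines_rowD[OF inj, of i0 r j0] j j' lt ne by auto
  have ut: "u \<noteq> t" using injective_lines_colD[OF inj, of q r i0] u j' lt ne by auto
  have "quadrangle n (u, j') (t, j') (t, j) (u, j)"
    using u j j' t ut jj by (auto simp: quadrangle_def)
  moreover have "quadrangle n (q, r) (i0, r) (i0, j0) (q, j0)"
    using lt ne by (auto simp: quadrangle_def)
  ultimately have "M $$ (u, j) = M $$ (q, j0)"
    using M(2) u j j' unfolding quadrangle_criterion_def by blast
  with j j' u jj ut show ?thesis by blast
qed

text \<open>
  A pigeonhole principle: were every \<open>B t\<close> to meet \<open>H\<close>, choosing a common element for each
  \<open>t < n\<close> would embed \<open>{..<n}\<close> into \<open>H\<close>.
\<close>

lemma ex_disjoint_from_small_set: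
  assumes H: "finite H" "card H < n"
    and uniq: "\<And>c s t. \<lbrakk>c \<in> H; s < n; t < n; c \<in> B s; c \<in> B t\<rbrakk> \<Longrightarrow> s = t"
  shows "\<exists>t<n. B t \<inter> H = {}"
proof (rule ccontr)
  assume "\<not> ?thesis"
  then have "\<forall>t\<in>{..<n}. \<exists>c. c \<in> B t \<inter> H" by auto
  then obtain h where h: "\<forall>t\<in>{..<n}. h t \<in> B t \<inter> H" by metis
  have "inj_on h {..<n}"
  proof (rule inj_onI)
    fix s t assume "s \<in> {..<n}" "t \<in> {..<n}" "h s = h t"
    with h show "s = t" using uniq[of "h t" s t] by (metis IntE lessThan_iff)
  qed
  moreover have "h ` {..<n} \<subseteq> H" using h by auto
  ultimately have "card {..<n} \<le> card H" using H(1) card_inj_on_le by blast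
  with H(2) show False by simp
qed

section \<open>Filling the holes\<close>

lemma delete_entries_index:
  assumes "M \<in> carrier_mat n n" "c \<in> cells n"
  shows "delete_entries M H $$ c = (if c \<in> H then None else Some (M $$ c))"
  using assms by (cases c) (auto simp: delete_entries_def cells_def)

lemma fillableI:
  assumes "P $$ d4 = None" "quadrangle n c1 c2 c3 c4" "quadrangle n d1 d2 d3 d4"
    and "\<forall>c\<in>{c1, c2, c3, c4, d1, d2, d3}. P $$ c \<noteq> None"
    and "P $$ c1 = P $$ d1" "P $$ c2 = P $$ d2" "P $$ c3 = P $$ d3" "P $$ c4 = Some x"
  shows "fillable n P d4 x"
  using assms unfolding fillable_def by blast

text \<open>
  The pigeonhole principle is applied to the copies \<open>B t\<close> of the block chosen by \<open>ex_corner\<close>; the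
  hole-free copy is not the original block, which contains the hole \<open>d\<close>.
\<close>

lemma fillable_any_hole:
  assumes n: "n > 3"
    and M: "cayley_matrix n M"
    and H: "H \<subseteq> cells n" "card H < n"
    and d: "d \<in> H"
  shows "fillable n (delete_entries M H) d (M $$ d)"
proof -
  have L: "latin_square n M" and Q: "quadrangle_criterion n M"
    using M by (auto simp: cayley_matrix_def)
  have C: "M \<in> carrier_mat n n" using L by (simp add: latin_square_def)
  note inj = latin_square_injective_lines[OF L]
  have fin: "finite H" using H(1) by (rule finite_subset) (simp add: cells_def)
  obtain i0 j0 where d_eq: "d = (i0, j0)" by (cases d)
  have lt: "i0 < n" "j0 < n" using d d_eq H(1) by (auto simp: cells_def)
  obtain q r where qr: "q < n" "r < n" "(q, j0) \<notin> H" "(i0, r) \<notin> H" "(q, r) \<notin> H"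
      "M $$ (q, r) \<noteq> M $$ (i0, j0)"
      and safe: "M $$ (q, j0) \<noteq> M $$ (i0, r) \<or> (\<forall>c\<in>H. M $$ c \<noteq> M $$ (i0, r))"
    using ex_corner[OF inj n H d[unfolded d_eq]] by auto
  have ne: "q \<noteq> i0" "r \<noteq> j0" using qr d d_eq by auto
  define copy_of where "copy_of t j j' u \<longleftrightarrow> j < n \<and> j' < n \<and> u < n \<and> u \<noteq> t \<and> j' \<noteq> j \<and>
     M $$ (t, j) = M $$ (i0, j0) \<and> M $$ (t, j') = M $$ (i0, r) \<and>
     M $$ (u, j') = M $$ (q, r) \<and> M $$ (u, j) = M $$ (q, j0)" for t j j' u
  have "\<forall>t<n. \<exists>j j' u. copy_of t j j' u"
    using ex_equal_quadrangle_in_row[OF L Q lt qr(1,2) ne] unfolding copy_of_def by blast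
  then obtain j j' u where "\<And>t. t < n \<Longrightarrow> copy_of t (j t) (j' t) (u t)"
    by metis
  note copy = this[unfolded copy_of_def]
  define B where "B t = {(t, j' t), (u t, j' t), (u t, j t), (t, j t)}" for t
  have "s = t" if c: "c \<in> H" "c \<in> B s" "c \<in> B t" and st: "s < n" "t < n" for c s t
  proof -
    have vals: "M $$ (i0, j0) \<noteq> M $$ (i0, r)" "M $$ (i0, r) \<noteq> M $$ (q, r)"
      "M $$ (q, r) \<noteq> M $$ (q, j0)" "M $$ (q, j0) \<noteq> M $$ (i0, j0)"
      using injective_lines_rowD[OF inj, of i0 j0 r] injective_lines_colD[OF inj, of i0 r q]
        injective_lines_rowD[OF inj, of q r j0] injective_lines_colD[OF inj, of q j0 i0]
        lt qr(1,2) ne by auto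
    have j_inj: "s = t" if "j s = j t"
      using injective_lines_colD[OF inj, of s "j t" t] copy[OF st(1)] copy[OF st(2)] st that by auto
    have j'_inj: "s = t" if "j' s = j' t"
      using injective_lines_colD[OF inj, of s "j' t" t] copy[OF st(1)] copy[OF st(2)] st that by auto
    note cs = copy[OF st(1)] and ct = copy[OF st(2)]
    have "c = (s, j' s) \<and> M $$ c = M $$ (i0, r) \<or> c = (u s, j' s) \<and> M $$ c = M $$ (q, r)
      \<or> c = (u s, j s) \<and> M $$ c = M $$ (q, j0) \<or> c = (s, j s) \<and> M $$ c = M $$ (i0, j0)"
      using c(2) cs by (auto simp: B_def)
    moreover have "c = (t, j' t) \<and> M $$ c = M $$ (i0, r) \<or> c = (u t, j' t) \<and> M $$ c = M $$ (q, r)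
      \<or> c = (u t, j t) \<and> M $$ c = M $$ (q, j0) \<or> c = (t, j t) \<and> M $$ c = M $$ (i0, j0)"
      using c(3) ct by (auto simp: B_def)
    \<comment> \<open>Since \<open>c\<close> is a hole, \<open>safe\<close> rules out that \<open>c\<close> is the \<open>\<beta>\<close> corner of one copy and the
        \<open>\<delta>\<close> corner of the other; the other mixed cases contradict \<open>vals\<close> or \<open>\<alpha> \<noteq> \<gamma>\<close>.\<close>
    ultimately show "s = t"
      using vals qr(6) safe c(1) j_inj j'_inj by (elim disjE conjE) auto
  qed
  then obtain t where t: "t < n" "B t \<inter> H = {}"
    using ex_disjoint_from_small_set[OF fin H(2), of B] by blast
  note ct = copy[OF t(1)]
  have qc: "quadrangle n (t, j' t) (u t, j' t) (u t, j t) (t, j t)"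
    using ct t(1) by (auto simp: quadrangle_def)
  have qd: "quadrangle n (i0, r) (q, r) (q, j0) (i0, j0)"
    using lt qr ne by (auto simp: quadrangle_def)
  have holes: "\<forall>c\<in>{(t, j' t), (u t, j' t), (u t, j t), (t, j t), (i0, r), (q, r), (q, j0)}.
      c \<notin> H \<and> c \<in> cells n"
    using t qr ct lt by (auto simp: B_def cells_def)
  have "d \<in> cells n" using d H(1) by auto
  then have "delete_entries M H $$ d = None"
    using d by (simp add: delete_entries_index[OF C])
  moreover have "\<forall>c\<in>{(t, j' t), (u t, j' t), (u t, j t), (t, j t), (i0, r), (q, r), (q, j0)}.
      delete_entries M H $$ c = Some (M $$ c)"
    using holes by (simp add: delete_entries_index[OF C])
  ultimately show ?thesis
    unfolding d_eq using ct by (intro fillableI[OF _ qc qd]) auto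
qed

text \<open>
  The entries of a partial matrix that are present agree with those of \<open>M\<close>, so filling a hole by the
  criterion is an instance of the criterion for \<open>M\<close>.
\<close>

lemma fillable_value_unique:
  assumes M: "M \<in> carrier_mat n n" "quadrangle_criterion n M"
    and "fillable n (delete_entries M H) d x"
  shows "x = M $$ d"
proof -
  from assms(3) obtain c1 c2 c3 c4 d1 d2 d3 where
    q: "quadrangle n c1 c2 c3 c4" "quadrangle n d1 d2 d3 d"
    and filled: "\<forall>c\<in>{c1, c2, c3, c4, d1, d2, d3}. delete_entries M H $$ c \<noteq> None"
    and eq: "delete_entries M H $$ c1 = delete_entries M H $$ d1"
      "delete_entries M H $$ c2 = delete_entries M H $$ d2"
      "delete_entries M H $$ c3 = delete_entries M H $$ d3"
      "delete_entries M H $$ c4 = Some x"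
    unfolding fillable_def by blast
  have "\<forall>c\<in>{c1, c2, c3, c4, d1, d2, d3}. delete_entries M H $$ c = Some (M $$ c)"
    using filled quadrangle_in_cells[OF q(1)] quadrangle_in_cells[OF q(2)]
    by (auto simp: delete_entries_index[OF M(1)] split: if_splits)
  with eq have "M $$ c1 = M $$ d1" "M $$ c2 = M $$ d2" "M $$ c3 = M $$ d3" "M $$ c4 = x"
    by auto
  with M(2) q show ?thesis unfolding quadrangle_criterion_def by blast
qed

lemma update_delete_entries:
  assumes "d \<notin> H"
  shows "update_mat (delete_entries M (insert d H)) d (Some (M $$ d)) = delete_entries M H"
  using assms by (intro eq_matI) (auto simp: delete_entries_def update_mat_def)

text \<open>
  By \<open>fillable_any_hole\<close> and \<open>fillable_value_unique\<close> each step is possible with exactly one value,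
  and by \<open>update_delete_entries\<close> it leads to \<open>M\<close> with the remaining holes.
\<close>

lemma fills_to_iff_original:
  assumes n: "n > 3"
    and M: "cayley_matrix n M"
    and "set ds \<subseteq> cells n" "length ds < n" "distinct ds"
  shows "fills_to n (delete_entries M (set ds)) ds Q \<longleftrightarrow> Q = map_mat Some M"
  using assms(3-)
proof (induction ds)
  case Nil
  have "delete_entries M {} = map_mat Some M"
    by (intro eq_matI) (auto simp: delete_entries_def)
  then show ?case by simp
next
  case (Cons d ds)
  have "fillable n (delete_entries M (set (d # ds))) d (M $$ d)"
    using Cons.prems by (intro fillable_any_hole[OF n M]) (auto simp: distinct_card)
  then have "fillable n (delete_entries M (set (d # ds))) d x \<longleftrightarrow> x = M $$ d" for x
    using fillable_value_unique[of M n "set (d # ds)" d x] M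
    by (auto simp: cayley_matrix_def latin_square_def)
  then have "fills_to n (delete_entries M (set (d # ds))) (d # ds) Q \<longleftrightarrow>
      fills_to n (delete_entries M (set ds)) ds Q"
    using Cons.prems update_delete_entries[of d "set ds" M] by simp
  then show ?case using Cons by simp
qed

theorem theorem1p1:
  fixes n :: nat and M :: "'a mat" and H :: "cell set" and ds :: "cell list"
  assumes "n > 3"
    and "cayley_matrix n M"
    and "H \<subseteq> cells n" and "card H \<le> n - 1"
    and "distinct ds" and "set ds = H"
  shows "(\<exists>Q. fills_to n (delete_entries M H) ds Q) \<and>
         (\<forall>Q. fills_to n (delete_entries M H) ds Q \<longrightarrow> Q = map_mat Some M)"
proof -
  have "length ds < n" using assms distinct_card[of ds] by simp
  with fills_to_iff_original[of n M ds] assms show ?thesis by auto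
qed

end
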